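(* No public bads allocation rule satisfying weak symmetry and lower contraction consistency returns only allocations that satisfy individual fair share. That is, for every rule $\phi$ satisfying weak symmetry and lower contraction consistency there exist a public bads instance $I$ and a lottery $x\in\phi(I)$ such that $x$ does not satisfy individual fair share in $I$.
   Context: A public bads instance $I=(N,A,c)$ consists of agents $N=\{1,\dots,n\}$, a finite set $A$ of alternatives (bads), and cost functions $c_i:A\to\mathbb{R}_{\ge 0}$, $i\in N$. $\Delta(A)$ is the set of lotteries (probability vectors) on $A$; $c_i(x)=\sum_{a\in A}x(a)c_i(a)$ and $c(x)=(c_i(x))_{i\in N}$. Write $\mathcal{C}(I)=\{c(x):x\in\Delta(A)\}$ and $\mathcal{C}_{\ge}(I)=\{z\in\mathbb{R}^N_{\ge0}:\exists z'\in\mathcal{C}(I)\text{ with }z\ge z'\text{ coordinatewise}\}$. Standing assumptions on instances: $0\notin\mathcal{C}(I)$, and for every $i\in N$ there is $a\in A$ with $c_i(a)<\max_{a'\in A}c_i(a')$. A public bads allocation rule $\phi$ maps each instance $I=(N,A,c)$ to a possibly empty set $\phi(I)\subseteq\Delta(A)$; write $c(\phi(I))=\{c(x):x\in\phi(I)\}$. Weak symmetry: an identity instance is an instance with $n$ agents and $n$ bads in which for each agent $i$ there is a unique bad $a_i$ with $c_i(a_i)=1$ and $c_{i'}(a_i)=0$ for all $i'\ne i$ (so $A=\{a_1,\dots,a_n\}$). $\phi$ is weakly symmetric if on every identity instance it returns exactly one allocation, namely the one placing weight $1/n$ on each bad. Lower contraction consistency: for any instances $I=(N,A,c)$ and $I'=(N,A',c')$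 with $\mathcal{C}_{\ge}(I)\subseteq\mathcal{C}_{\ge}(I')$, we have $c'(\phi(I'))\cap\mathcal{C}(I)\subseteq c(\phi(I))$. Individual fair share: $x\in\Delta(A)$ satisfies it if $c_i(x)\le\frac1n\min_{a\in A}c_i(a)+\frac{n-1}{n}\max_{a\in A}c_i(a)$ for all $i\in N$. *)

theory Defs
  imports Complex_Main "HOL-Library.FuncSet" "HOL-Library.Infinite_Typeclass"
begin

text \<open>
  The alternatives of an instance form a finite subset of the type \<open>'a\<close>. Functions with a set-sized
  domain (cost functions, lotteries, cost vectors in $\mathbb{R}^N$) are extensional, so that
  equality of the HOL objects is equality of the functions on their domains.
\<close>

record 'a bads_instance =
  num_agents :: nat
  alts :: "'a set"
  cost :: "nat \<Rightarrow> 'a \<Rightarrow> real"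

definition agents :: "'a bads_instance \<Rightarrow> nat set" where
  "agents I = {1..num_agents I}"

definition lotteries :: "'a bads_instance \<Rightarrow> ('a \<Rightarrow> real) set" where
  "lotteries I = {x \<in> alts I \<rightarrow>\<^sub>E {0..}. (\<Sum>a\<in>alts I. x a) = 1}"

definition expected_cost :: "'a bads_instance \<Rightarrow> nat \<Rightarrow> ('a \<Rightarrow> real) \<Rightarrow> real" where
  "expected_cost I i x = (\<Sum>a\<in>alts I. x a * cost I i a)"

definition cost_vector :: "'a bads_instance \<Rightarrow> ('a \<Rightarrow> real) \<Rightarrow> (nat \<Rightarrow> real)" where
  "cost_vector I x = (\<lambda>i\<in>agents I. expected_cost I i x)"

definition cost_set :: "'a bads_instance \<Rightarrow> (nat \<Rightarrow> real) set" where
  "cost_set I = cost_vector I ` lotteries I"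

definition upper_cost_set :: "'a bads_instance \<Rightarrow> (nat \<Rightarrow> real) set" where
  "upper_cost_set I =
     {z \<in> agents I \<rightarrow>\<^sub>E {0..}. \<exists>z'\<in>cost_set I. \<forall>i\<in>agents I. z' i \<le> z i}"

definition public_bads_instance :: "'a bads_instance \<Rightarrow> bool" where
  "public_bads_instance I \<longleftrightarrow>
     1 \<le> num_agents I \<and>
     finite (alts I) \<and> alts I \<noteq> {} \<and>
     cost I \<in> agents I \<rightarrow>\<^sub>E (alts I \<rightarrow>\<^sub>E {0..}) \<and>
     (\<lambda>i\<in>agents I. 0) \<notin> cost_set I \<and>
     (\<forall>i\<in>agents I. \<exists>a\<in>alts I. cost I i a < Max (cost I i ` alts I))"

text \<open>Only the values of a rule on public bads instances are meaningful.\<close>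

type_synonym 'a rule = "'a bads_instance \<Rightarrow> ('a \<Rightarrow> real) set"

definition allocation_rule :: "'a rule \<Rightarrow> bool" where
  "allocation_rule \<phi> \<longleftrightarrow> (\<forall>I. public_bads_instance I \<longrightarrow> \<phi> I \<subseteq> lotteries I)"

definition identity_instance :: "'a bads_instance \<Rightarrow> bool" where
  "identity_instance I \<longleftrightarrow>
     public_bads_instance I \<and>
     card (alts I) = num_agents I \<and>
     (\<forall>i\<in>agents I. \<exists>!a. a \<in> alts I \<and> cost I i a = 1 \<and>
        (\<forall>i'\<in>agents I. i' \<noteq> i \<longrightarrow> cost I i' a = 0))"

definition weakly_symmetric :: "'a rule \<Rightarrow> bool" where
  "weakly_symmetric \<phi> \<longleftrightarrow>
     (\<forall>I. identity_instance I \<longrightarrow> \<phi> I = {\<lambda>a\<in>alts I. 1 / real (num_agents I)})"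

definition lower_contraction_consistent :: "'a rule \<Rightarrow> bool" where
  "lower_contraction_consistent \<phi> \<longleftrightarrow>
     (\<forall>I I'. public_bads_instance I \<and> public_bads_instance I' \<and> num_agents I = num_agents I' \<and>
        upper_cost_set I \<subseteq> upper_cost_set I' \<longrightarrow>
        cost_vector I' ` \<phi> I' \<inter> cost_set I \<subseteq> cost_vector I ` \<phi> I)"

definition individual_fair_share :: "'a bads_instance \<Rightarrow> ('a \<Rightarrow> real) \<Rightarrow> bool" where
  "individual_fair_share I x \<longleftrightarrow>
     (\<forall>i\<in>agents I. expected_cost I i x \<le>
        1 / real (num_agents I) * Min (cost I i ` alts I) +
        (real (num_agents I) - 1) / real (num_agents I) * Max (cost I i ` alts I))"

end

theory Submission
  imports Defs
begin

text \<open>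
  Two agents suffice. Let \<open>I\<^sub>t\<close> have two bads with cost vectors $(0,1)$ and $(t,1-t)$, so that
  $\mathcal{C}(I_t)$ is the segment joining them. Then \<open>I\<^sub>1\<close> is an identity instance, where weak
  symmetry selects the cost vector $(1/2,1/2)$. Shrinking $t$ to $1/2$ keeps this vector feasible,
  so lower contraction consistency forces it to be selected in \<open>I\<^bsub>1/2\<^esub>\<close>. There, however, it is
  the worst possible outcome for agent 1, whose fair share bound has dropped to $1/4$.
\<close>

definition chord_instance :: "'a \<Rightarrow> 'a \<Rightarrow> real \<Rightarrow> 'a bads_instance" where
  "chord_instance a b t = \<lparr>num_agents = 2, alts = {a, b},
     cost = (\<lambda>i\<in>{1..2}. \<lambda>x\<in>{a, b}. if x = a then (if i = 1 then 0 else 1)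
                                     else (if i = 1 then t else 1 - t))\<rparr>"

lemma chord_instance_simps [simp]:
  "num_agents (chord_instance a b t) = 2"
  "alts (chord_instance a b t) = {a, b}"
  "agents (chord_instance a b t) = {1, 2}"
  by (auto simp: chord_instance_def agents_def)

lemma cost_chord_instance [simp]:
  assumes "a \<noteq> b"
  shows "cost (chord_instance a b t) (Suc 0) a = 0"
    and "cost (chord_instance a b t) 2 a = 1"
    and "cost (chord_instance a b t) (Suc 0) b = t"
    and "cost (chord_instance a b t) 2 b = 1 - t"
  using assms by (auto simp: chord_instance_def)

lemma cost_vector_chord_instance:
  assumes "a \<noteq> b" "x a + x b = 1"
  shows "cost_vector (chord_instance a b t) x =
    (\<lambda>i\<in>{1, 2}. if i = 1 then t * x b else 1 - t * x b)"
  using assms by (auto simp: cost_vector_def expected_cost_def restrict_def fun_eq_iff algebra_simps)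

text \<open>Both bads have costs summing to 1 over the agents, so agent 1's cost, \<open>t\<close>
  times the weight on \<open>b\<close>, determines the vector. Parametrising by this cost instead of
  by the weight makes the sets for different \<open>t\<close> visibly nested.\<close>

lemma cost_set_chord_instance:
  assumes "a \<noteq> b" "0 < t"
  shows "cost_set (chord_instance a b t) = (\<lambda>s. \<lambda>i\<in>{1, 2}. if i = 1 then s else 1 - s) ` {0..t}"
    (is "_ = ?v ` _")
proof (intro equalityI subsetI)
  fix z assume "z \<in> cost_set (chord_instance a b t)"
  then obtain x where x: "x \<in> lotteries (chord_instance a b t)"
    and z: "z = cost_vector (chord_instance a b t) x"
    by (auto simp: cost_set_def)
  have "x a + x b = 1" "0 \<le> x a" "0 \<le> x b"
    using x assms(1) by (auto simp: lotteries_def PiE_def Pi_def)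
  then have "z = ?v (t * x b)" "t * x b \<in> {0..t}"
    using z assms by (auto simp: cost_vector_chord_instance mult_left_le)
  then show "z \<in> ?v ` {0..t}" by blast
next
  fix z assume "z \<in> ?v ` {0..t}"
  then obtain s where s: "0 \<le> s" "s \<le> t" and z: "z = ?v s" by auto
  \<comment> \<open>Weight \<open>s / t\<close> on \<open>b\<close> is what gives agent 1 the cost
    \<open>s\<close>.\<close>
  define x where "x = (\<lambda>y\<in>{a, b}. if y = a then 1 - s / t else s / t)"
  have "x \<in> lotteries (chord_instance a b t)"
    using s assms by (auto simp: lotteries_def x_def)
  moreover have "cost_vector (chord_instance a b t) x = z"
    using s assms z by (subst cost_vector_chord_instance) (auto simp: x_def)
  ultimately show "z \<in> cost_set (chord_instance a b t)"
    by (auto simp: cost_set_def)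
qed

lemma upper_cost_set_chord_instance_mono:
  assumes "a \<noteq> b" "0 < t" "t \<le> u"
  shows "upper_cost_set (chord_instance a b t) \<subseteq> upper_cost_set (chord_instance a b u)"
proof -
  have "cost_set (chord_instance a b t) \<subseteq> cost_set (chord_instance a b u)"
    unfolding cost_set_chord_instance[OF assms(1,2)]
      cost_set_chord_instance[OF assms(1) less_le_trans[OF assms(2,3)]]
    using assms(3) by (intro image_mono) auto
  then show ?thesis by (auto simp: upper_cost_set_def)
qed

text \<open>Agent 1 strictly prefers \<open>a\<close> since \<open>0 < t\<close>, and agent 2
  strictly prefers \<open>b\<close> since \<open>1 - t < 1\<close>; \<open>t \<le> 1\<close> keeps
  agent 2's costs nonnegative. The zero vector is off the line of coordinate sum 1.\<close>

lemma public_bads_chord_instance: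
  assumes "a \<noteq> b" "0 < t" "t \<le> 1"
  shows "public_bads_instance (chord_instance a b t)"
proof -
  have "cost (chord_instance a b t) \<in> {1, 2} \<rightarrow>\<^sub>E ({a, b} \<rightarrow>\<^sub>E {0..})"
    using assms by (auto simp: chord_instance_def PiE_def Pi_def extensional_def)
  moreover have "(\<lambda>i\<in>{1, 2}. 0) \<notin> cost_set (chord_instance a b t)"
  proof
    assume "(\<lambda>i\<in>{1, 2}. 0) \<in> cost_set (chord_instance a b t)"
    then obtain s :: real where
      "(\<lambda>i\<in>{1, 2 :: nat}. 0) = (\<lambda>i\<in>{1, 2}. if i = 1 then s else 1 - s)"
      unfolding cost_set_chord_instance[OF assms(1,2)] by blast
    from fun_cong[OF this, of 1] fun_cong[OF this, of 2] show False by simp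
  qed
  ultimately show ?thesis
    using assms by (auto simp: public_bads_instance_def)
qed

text \<open>At \<open>t = 1\<close> the cost vectors are (0,1) and (1,0): \<open>b\<close> is the
  bad of agent 1 and \<open>a\<close> that of agent 2.\<close>

lemma identity_chord_instance:
  assumes "a \<noteq> b"
  shows "identity_instance (chord_instance a b 1)"
  using assms public_bads_chord_instance[OF assms, of 1]
  by (auto simp: identity_instance_def)

theorem theorem5p5:
  fixes \<phi> :: "'a::infinite rule"
  assumes "allocation_rule \<phi>"
    and "weakly_symmetric \<phi>"
    and "lower_contraction_consistent \<phi>"
  shows "\<exists>I x. public_bads_instance I \<and> x \<in> \<phi> I \<and> \<not> individual_fair_share I x"
proof -
  obtain a b :: 'a where ab: "a \<noteq> b"
    using ex_new_if_finite[OF infinite_UNIV, of "{undefined}"] by auto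
  let ?I = "chord_instance a b (1/2)" and ?J = "chord_instance a b 1"
  let ?z = "\<lambda>i\<in>{1, 2 :: nat}. if i = 1 then 1/2 else 1 - 1/2 :: real"
  have "?z \<in> cost_vector ?J ` \<phi> ?J"
    using assms(2) identity_chord_instance[OF ab] ab
    by (auto simp: weakly_symmetric_def cost_vector_chord_instance)
  moreover have "?z \<in> cost_set ?I"
    \<comment> \<open>The parameter 1/2 is the right endpoint of the interval, attained by putting
      all weight on \<open>b\<close>.\<close>
    using ab by (subst cost_set_chord_instance) (auto intro!: image_eqI[where x = "1/2"])
  moreover have "public_bads_instance ?I" "public_bads_instance ?J"
    using public_bads_chord_instance[OF ab] by simp_all
  moreover have "upper_cost_set ?I \<subseteq> upper_cost_set ?J"
    using upper_cost_set_chord_instance_mono[OF ab] by simp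
  ultimately have "?z \<in> cost_vector ?I ` \<phi> ?I"
    using assms(3)[unfolded lower_contraction_consistent_def, rule_format, of ?I ?J]
    by (simp add: subset_iff)
  then obtain x where x: "x \<in> \<phi> ?I" "?z = cost_vector ?I x" by blast
  \<comment> \<open>Consistency fixes only the cost vector of \<open>x\<close>; its first coordinate
    is enough to exceed agent 1's bound.\<close>
  from fun_cong[OF x(2), of 1] have "expected_cost ?I 1 x = 1/2"
    by (simp add: cost_vector_def)
  then have "\<not> individual_fair_share ?I x"
    using ab by (simp add: individual_fair_share_def)
  with x(1) \<open>public_bads_instance ?I\<close> show ?thesis by blast
qed

end
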